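(* Let $N\ge1$ and let $f=|0,\dots,N-1|$, $g=|0,\dots,N-2,N|$, $h=|0,\dots,N-2,N+1|$, $s=|0,\dots,N-3,N-1,N|$ be Casoratians built from $\boldsymbol\psi$ (see context), regarded as functions of $(n,m,\alpha)$. Then (GD-4 (A-2) bilinear form) $$f(a\widetilde{\check f}+\widetilde{\check g})+(p-a)\widetilde f\check f-(pf+g)\widetilde{\check f}=0,\qquad f(a\widehat{\check f}+\widehat{\check g})+(q-a)\widehat f\check f-(qf+g)\widehat{\check f}=0,$$ $$f(a^2\widetilde{\check f}+a\widetilde{\check g}+\widetilde{\check s})-pf(a\widetilde{\check f}+\widetilde{\check g})+(p-a)\widetilde f(a\check f+\check g)-\widetilde{\check f}s=0,$$ $$f(a^2\widehat{\check f}+a\widehat{\check g}+\widehat{\check s})-qf(a\widehat{\check f}+\widehat{\check g})+(q-a)\widehat f(a\check f+\check g)-\widehat{\check f}s=0,$$ $$\widetilde f(pg+h)-\widetilde g(pf+g)+f\widetilde s=0,\qquad \widehat f(qg+h)-\widehat g(qf+g)+f\widehat s=0,$$ $$(p-q)(\widetilde f\widehat f-f\widehat{\widetilde f})+\widetilde f\widehat g-\widehat f\widetilde g=0,$$ $$\big[H(p,q)\widehat{\widetilde f}\check f+\widehat{\widetilde h}\check f-(p+q-\alpha_3)\widehat{\widetilde g}\check f+((p+q-\alpha_3)\widehat{\widetilde f}-\widehat{\widetilde g})(a\check f+\check g)+\widehat{\widetilde f}(a^2\check f+a\check g+\check s)\big](p-q)-p_a\widehat f\widetilde{\check f}+q_a\widetilde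 f\widehat{\check f}=0.$$
   Context: Fix $\alpha_1,\alpha_2,\alpha_3\in\mathbb C$, $G(\omega,k)=\omega^4-k^4+\alpha_3(\omega^3-k^3)+\alpha_2(\omega^2-k^2)+\alpha_1(\omega-k)$, $H(p,q)=p^2+pq+q^2-\alpha_3(p+q)+\alpha_2$. Let $p,q,a,b\in\mathbb C$ be pairwise distinct, and $p_a=G(-p,-a)/(p-a)$, $q_a=G(-q,-a)/(q-a)$. Fix $N\ge1$, $k_1,\dots,k_N\in\mathbb C$; for each $s$ let $\omega_1(k_s),\dots,\omega_4(k_s)$ be the four roots in $\omega$ of $G(-\omega,-k_s)=0$, with $\omega_4(k_s)=k_s$. For constants $\rho^{(0)}_{j,s}$ let $\psi_s(n,m,\alpha,\beta,l)=\sum_{j=1}^4\rho^{(0)}_{j,s}(-\omega_j(k_s))^l(p-\omega_j(k_s))^n(q-\omega_j(k_s))^m(a-\omega_j(k_s))^\alpha(b-\omega_j(k_s))^\beta$ and $\boldsymbol\psi(l)=(\psi_1,\dots,\psi_N)^T$. Casoratian notation: $|l_1,\dots,l_N|=\det(\boldsymbol\psi(l_1),\dots,\boldsymbol\psi(l_N))$; a run "$0,\dots,j$" with $j<0$ is empty, and if the listed indices number more than $N$ the symbol is $0$. Shifts: $\widetilde F=F(n+1,m,\alpha)$, $\widehat F=F(n,m+1,\alpha)$, $\check F=F(n,m,\alpha-1)$, compositions combine these (e.g. $\widetilde{\check f}=f(n+1,m,\alpha-1)$, $\widehat{\widetilde f}=f(n+1,m+1,\alpha)$). *)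

theory Defs
  imports Complex_Main "Jordan_Normal_Form.Determinant"
begin

definition Gfun :: "complex \<Rightarrow> complex \<Rightarrow> complex \<Rightarrow> complex \<Rightarrow> complex \<Rightarrow> complex" where
  "Gfun \<alpha>1 \<alpha>2 \<alpha>3 w k =
     w^4 - k^4 + \<alpha>3 * (w^3 - k^3) + \<alpha>2 * (w^2 - k^2) + \<alpha>1 * (w - k)"

definition Hfun :: "complex \<Rightarrow> complex \<Rightarrow> complex \<Rightarrow> complex \<Rightarrow> complex" where
  "Hfun \<alpha>2 \<alpha>3 p q = p^2 + p*q + q^2 - \<alpha>3 * (p + q) + \<alpha>2"

text \<open>psi s (n,m,alpha,beta,l); rho j s and omega s j indexed with s in 1..N, j in 1..4.\<close>
definition psi :: "(nat \<Rightarrow> nat \<Rightarrow> complex) \<Rightarrow> (nat \<Rightarrow> nat \<Rightarrow> complex) \<Rightarrow>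
    complex \<Rightarrow> complex \<Rightarrow> complex \<Rightarrow> complex \<Rightarrow> nat \<Rightarrow> int \<Rightarrow> int \<Rightarrow> int \<Rightarrow> int \<Rightarrow> nat \<Rightarrow> complex" where
  "psi \<rho> \<omega> p q a b s n m \<alpha> \<beta> l =
     (\<Sum>j\<in>{1..4::nat}. \<rho> j s * (- \<omega> s j) ^ l * (p - \<omega> s j) powi n * (q - \<omega> s j) powi m
        * (a - \<omega> s j) powi \<alpha> * (b - \<omega> s j) powi \<beta>)"

text \<open>Casoratian |l_1,...,l_N| = det(psi(l_1),...,psi(l_N)); column j is the vector
  (psi_1(l_j),...,psi_N(l_j)).  If the index list does not have exactly N entries it is 0
  (only the case of more than N entries occurs in the theorem).\<close>
definition casor :: "nat \<Rightarrow> (nat \<Rightarrow> nat \<Rightarrow> complex) \<Rightarrow> (nat \<Rightarrow> nat \<Rightarrow> complex) \<Rightarrow>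
    complex \<Rightarrow> complex \<Rightarrow> complex \<Rightarrow> complex \<Rightarrow> int \<Rightarrow> int \<Rightarrow> int \<Rightarrow> int \<Rightarrow> nat list \<Rightarrow> complex" where
  "casor N \<rho> \<omega> p q a b n m \<alpha> \<beta> ls =
     (if length ls = N
      then det (mat N N (\<lambda>(i, j). psi \<rho> \<omega> p q a b (i + 1) n m \<alpha> \<beta> (ls ! j)))
      else 0)"

end

theory Submission
  imports Defs
begin

text \<open>
  Let row \<open>r\<close> of the Casoratian act as a linear functional \<open>L r\<close> on polynomials in \<open>x\<close>, where \<open>x\<close> stands
  for \<open>- \<omega>\<close>. A shift of the lattice in direction \<open>c\<close> is then precomposition with multiplication by \<open>x + c\<close>,
  and every Casoratian is a determinant \<open>det (L j (P i))\<close>. Cramer's rule gives the polynomial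
  \<open>F = x^N |0..N-1| - x^(N-1) |0..N-2,N| + x^(N-2) |0..N-3,N-1,N| - ...\<close>, which every functional annihilates and
  whose value at \<open>-c\<close> is, up to sign, \<open>|0..N-1|\<close> shifted in direction \<open>c\<close>. All eight identities say
  \<open>det (e, x e, ..., x^(N-2) e, X) = 0\<close> for an annihilated \<open>X\<close>, reduced modulo \<open>e\<close> by Lagrange interpolation.
  The first seven use \<open>X = (x + c) F\<close> with \<open>F\<close> formed after the shift in direction \<open>c\<close>. For the last one, the
  quartic \<open>G(x, -a)\<close> acts on each row as a scalar because its argument runs through roots of
  \<open>G(-\<omega>, -k) = 0\<close>, so \<open>X = G(x, -a) F\<close> is annihilated too; it is tested against \<open>e = (x+a)(x+p)(x+q)\<close>.
\<close>

section \<open>Determinants of linear functionals on polynomials\<close>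

text \<open>Polynomials index the rows and functionals the columns, the transpose of the Casoratian
  matrix, so that a change of polynomial basis is a row operation.\<close>

definition cdet :: "(nat \<Rightarrow> 'a::comm_ring_1 poly \<Rightarrow> 'a) \<Rightarrow> nat \<Rightarrow> (nat \<Rightarrow> 'a poly) \<Rightarrow> 'a" where
  "cdet L n P = det (mat n n (\<lambda>(i, j). L j (P i)))"

lemma cdet_cong:
  assumes "\<And>i. i < n \<Longrightarrow> P i = Q i" and "\<And>j. j < n \<Longrightarrow> L j = K j"
  shows "cdet L n P = cdet K n Q"
  unfolding cdet_def using assms by (intro arg_cong[of _ _ det] eq_matI) auto

definition poly_functional :: "('a::comm_ring_1 poly \<Rightarrow> 'a) \<Rightarrow> bool" where
  "poly_functional l \<longleftrightarrow> (\<forall>P Q. l (P + Q) = l P + l Q) \<and> (\<forall>c P. l (Polynomial.smult c P) = c * l P)"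

lemma poly_functionalI:
  assumes "\<And>P Q. l (P + Q) = l P + l Q" and "\<And>c P. l (Polynomial.smult c P) = c * l P"
  shows "poly_functional l"
  using assms by (simp add: poly_functional_def)

lemma poly_functional_add: "poly_functional l \<Longrightarrow> l (P + Q) = l P + l Q"
  and poly_functional_smult: "poly_functional l \<Longrightarrow> l (Polynomial.smult c P) = c * l P"
  by (simp_all add: poly_functional_def)

lemma poly_functional_0: "poly_functional l \<Longrightarrow> l 0 = 0"
  using poly_functional_smult[of l 0 0] by simp

lemma poly_functional_diff: "poly_functional l \<Longrightarrow> l (P - Q) = l P - l Q"
  using poly_functional_add[of l "P - Q" Q] by simp

lemma poly_functional_sum: "poly_functional l \<Longrightarrow> l (sum P A) = (\<Sum>i\<in>A. l (P i))"
  by (induction A rule: infinite_finite_induct) (auto simp: poly_functional_add poly_functional_0)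

lemma poly_functional_monom_expansion:
  assumes "poly_functional l" and "degree P \<le> n"
  shows "l (e * P) = (\<Sum>i\<le>n. coeff P i * l (e * monom 1 i))"
proof -
  have "P = (\<Sum>i\<le>n. Polynomial.smult (coeff P i) (monom 1 i))"
    using poly_as_sum_of_monoms'[OF assms(2)] by (simp add: smult_monom)
  hence "l (e * P) = l (e * (\<Sum>i\<le>n. Polynomial.smult (coeff P i) (monom 1 i)))" by simp
  thus ?thesis
    by (simp add: sum_distrib_left poly_functional_sum[OF assms(1)] poly_functional_smult[OF assms(1)])
qed

text \<open>The cofactors along row \<open>k\<close> do not involve that row, so Laplace expansion
  along it is a fixed linear combination of the values \<open>L j X\<close>.\<close>

lemma cdet_row_functional:
  assumes k: "k < n" and lin: "\<And>j. poly_functional (L j)"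
  shows "poly_functional (\<lambda>X. cdet L n (P(k := X)))"
proof -
  define \<kappa> where "\<kappa> j = cofactor (mat n n (\<lambda>(i, j). L j (P i))) k j" for j
  have del: "mat_delete (mat n n (\<lambda>(i, j). L j (if i = k then X else P i))) k j =
      mat_delete (mat n n (\<lambda>(i, j). L j (P i))) k j" if "j < n" for j X
    unfolding mat_delete_def using k that by (intro eq_matI) auto
  have exp: "cdet L n (P(k := X)) = (\<Sum>j<n. L j X * \<kappa> j)" for X
    unfolding cdet_def using k
    by (subst laplace_expansion_row[of _ n k]) (auto simp: \<kappa>_def cofactor_def del intro!: sum.cong)
  show ?thesis
    unfolding exp
    by (rule poly_functionalI)
      (auto simp: poly_functional_add[OF lin] poly_functional_smult[OF lin] sum_distrib_left
        sum.distrib[symmetric] algebra_simps intro!: sum.cong)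
qed

lemma cdet_eq_0_null_row:
  assumes k: "k < n" and "P k = X" and X: "\<And>j. j < n \<Longrightarrow> L j X = 0"
  shows "cdet L n P = 0"
  unfolding cdet_def using assms
  by (subst laplace_expansion_row[of _ n k]) auto

lemma cdet_eq_0_equal_rows:
  assumes "i \<noteq> k" "i < n" "k < n" "P i = P k"
  shows "cdet L n P = 0"
  unfolding cdet_def using assms
  by (intro det_identical_rows[of _ n i k]) auto

text \<open>The matrix of coefficients is lower triangular with unit diagonal, so passing from
  monomials to any monic graded basis multiplies the determinant by 1. The common factor
  \<open>e\<close> is carried along throughout.\<close>

lemma cdet_monic:
  assumes lin: "\<And>j. poly_functional (L j)"
    and deg: "\<And>i. i < n \<Longrightarrow> degree (P i) = i" and lead: "\<And>i. i < n \<Longrightarrow> coeff (P i) i = 1"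
  shows "cdet L n (\<lambda>i. e * P i) = cdet L n (\<lambda>i. e * monom 1 i)"
proof -
  define C where "C = mat n n (\<lambda>(i, j). coeff (P i) j)"
  have C: "C \<in> carrier_mat n n" by (simp add: C_def)
  have "det C = 1"
    by (subst det_lower_triangular[OF _ C])
      (auto simp: C_def deg lead coeff_eq_0 prod_list_diag_prod)
  moreover have "mat n n (\<lambda>(i, j). L j (e * P i)) = C * mat n n (\<lambda>(i, j). L j (e * monom 1 i))"
  proof (rule eq_matI)
    fix i j assume "i < dim_row (C * mat n n (\<lambda>(i, j). L j (e * monom 1 i)))"
      "j < dim_col (C * mat n n (\<lambda>(i, j). L j (e * monom 1 i)))"
    hence ij: "i < n" "j < n" by (auto simp: C_def)
    have "L j (e * P i) = (\<Sum>k\<le>n - 1. coeff (P i) k * L j (e * monom 1 k))"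
      using deg[of i] ij by (intro poly_functional_monom_expansion lin) auto
    also have "{..n - 1} = {0..<n}" using ij by auto
    finally show "mat n n (\<lambda>(i, j). L j (e * P i)) $$ (i, j) =
        (C * mat n n (\<lambda>(i, j). L j (e * monom 1 i))) $$ (i, j)"
      using ij by (simp add: C_def scalar_prod_def)
  qed (auto simp: C_def)
  ultimately show ?thesis
    unfolding cdet_def using C by (simp add: det_mult[of _ n])
qed

text \<open>The basis \<open>1, x+c, (x+c)x, (x+c)x^2, ...\<close> is monic and graded, and all its
  members but the first vanish at \<open>-c\<close>. It serves both to evaluate \<open>wave\<close>
  and to recognise a divisor of \<open>e\<close> in the last row of \<open>border\<close>.\<close>

lemma cdet_newton_basis:
  fixes L :: "nat \<Rightarrow> 'a::field poly \<Rightarrow> 'a"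
  assumes "\<And>j. poly_functional (L j)"
  shows "cdet L n (\<lambda>i. e * (case i of 0 \<Rightarrow> 1 | Suc k \<Rightarrow> [:c, 1:] * monom 1 k)) = cdet L n (\<lambda>i. e * monom 1 i)"
proof (intro cdet_monic assms)
  fix i
  show "degree (case i of 0 \<Rightarrow> 1 | Suc k \<Rightarrow> [:c, 1:] * monom (1::'a) k) = i"
    by (cases i) (auto simp: degree_mult_eq degree_monom_eq simp del: mult_pCons_left)
  show "coeff (case i of 0 \<Rightarrow> 1 | Suc k \<Rightarrow> [:c, 1:] * monom (1::'a) k) i = 1"
    by (cases i) auto
qed

section \<open>Casoratian symbols and the annihilated polynomial\<close>

text \<open>
  From here on \<open>N = M + 1\<close>. In Casoratian notation \<open>tau\<close> is \<open>|0..N-1|\<close>, \<open>gap L M k\<close> is \<open>|0..N|\<close> without the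
  index \<open>k\<close>, and \<open>hook\<close> is \<open>|0..N-2,N+1|\<close>. The polynomial \<open>wave\<close> is the \<open>F\<close> of the introduction.
\<close>

definition twist :: "(nat \<Rightarrow> 'a::comm_ring_1 poly \<Rightarrow> 'a) \<Rightarrow> 'a poly \<Rightarrow> nat \<Rightarrow> 'a poly \<Rightarrow> 'a" where
  "twist L e = (\<lambda>j P. L j (e * P))"

definition tau :: "(nat \<Rightarrow> 'a::comm_ring_1 poly \<Rightarrow> 'a) \<Rightarrow> nat \<Rightarrow> 'a" where
  "tau L M = cdet L (Suc M) (monom 1)"

definition gap :: "(nat \<Rightarrow> 'a::comm_ring_1 poly \<Rightarrow> 'a) \<Rightarrow> nat \<Rightarrow> nat \<Rightarrow> 'a" where
  "gap L M k = cdet L (Suc M) (\<lambda>i. monom 1 (if i < k then i else Suc i))"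

definition hook :: "(nat \<Rightarrow> 'a::comm_ring_1 poly \<Rightarrow> 'a) \<Rightarrow> nat \<Rightarrow> 'a" where
  "hook L M = cdet L (Suc M) (\<lambda>i. monom 1 (if i < M then i else M + 2))"

definition wave :: "(nat \<Rightarrow> 'a::comm_ring_1 poly \<Rightarrow> 'a) \<Rightarrow> nat \<Rightarrow> 'a poly" where
  "wave L M = (\<Sum>k\<le>Suc M. monom ((-1) ^ (k + Suc M) * gap L M k) k)"

text \<open>The determinant \<open>det (e, x e, ..., x^(N-2) e, X)\<close> of the introduction, with
  its last row left free.\<close>

definition border :: "(nat \<Rightarrow> 'a::comm_ring_1 poly \<Rightarrow> 'a) \<Rightarrow> nat \<Rightarrow> 'a poly \<Rightarrow> 'a poly \<Rightarrow> 'a" where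
  "border L M e X = cdet L (Suc M) (\<lambda>i. if i = M then X else e * monom 1 i)"

lemma twist_functional:
  assumes "\<And>j. poly_functional (L j)"
  shows "poly_functional (twist L e j)"
  by (rule poly_functionalI)
    (simp_all add: twist_def distrib_left poly_functional_add[OF assms] poly_functional_smult[OF assms])

lemma twist_twist [simp]: "twist (twist L d) e = twist L (d * e)"
  by (simp add: twist_def mult.assoc)

lemma cdet_twist: "cdet (twist L e) n P = cdet L n (\<lambda>i. e * P i)"
  by (simp add: cdet_def twist_def)

lemma gap_top: "gap L M (Suc M) = tau L M"
  unfolding gap_def tau_def by (rule cdet_cong) auto

lemma coeff_wave: "coeff (wave L M) k = (if k \<le> Suc M then (-1) ^ (k + Suc M) * gap L M k else 0)"
  by (simp add: wave_def coeff_sum del: sum.atMost_Suc)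

lemma degree_wave: "degree (wave L M) \<le> Suc M"
  by (intro degree_le) (simp add: coeff_wave)

text \<open>Laplace expansion along the additional last column, which belongs to \<open>E\<close>.
  For monomials the minors are exactly the symbols \<open>gap L M k\<close>.\<close>

lemma cdet_extended:
  "cdet (L(Suc M := E)) (Suc (Suc M)) P =
    (\<Sum>k\<le>Suc M. E (P k) * ((-1) ^ (k + Suc M) * cdet L (Suc M) (\<lambda>i. P (if i < k then i else Suc i))))"
proof -
  let ?A = "mat (Suc (Suc M)) (Suc (Suc M)) (\<lambda>(i, j). (L(Suc M := E)) j (P i))"
  have del: "mat_delete ?A k (Suc M) =
      mat (Suc M) (Suc M) (\<lambda>(i, j). L j (P (if i < k then i else Suc i)))" if "k \<le> Suc M" for k
    unfolding mat_delete_def using that by (intro eq_matI) auto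
  have "det ?A = (\<Sum>k<Suc (Suc M). ?A $$ (k, Suc M) * cofactor ?A k (Suc M))"
    by (intro laplace_expansion_column) auto
  also have "\<dots> = (\<Sum>k\<le>Suc M. E (P k) *
      ((-1) ^ (k + Suc M) * cdet L (Suc M) (\<lambda>i. P (if i < k then i else Suc i))))"
    unfolding lessThan_Suc_atMost
    by (intro sum.cong refl) (simp add: cofactor_def del cdet_def del: fun_upd_apply, simp)
  finally show ?thesis by (simp add: cdet_def)
qed

text \<open>The signed gaps in \<open>wave\<close> are the cofactors of the last column, so applying
  \<open>E\<close> to \<open>wave\<close> restores the determinant of size
  \<open>N+1\<close>.\<close>

lemma cdet_extended_wave:
  assumes "poly_functional E"
  shows "cdet (L(Suc M := E)) (Suc (Suc M)) (monom 1) = E (wave L M)"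
proof -
  have "E (wave L M) = (\<Sum>k\<le>Suc M. coeff (wave L M) k * E (1 * monom 1 k))"
    using poly_functional_monom_expansion[OF assms, of "wave L M" "Suc M" 1] degree_wave[of L M] by (simp del: sum.atMost_Suc)
  thus ?thesis by (simp add: cdet_extended coeff_wave gap_def mult_ac del: sum.atMost_Suc)
qed

text \<open>Taking the additional functional to be \<open>L j\<close> itself repeats a
  column.\<close>

lemma wave_null:
  assumes "\<And>j. poly_functional (L j)" and "j \<le> M"
  shows "L j (wave L M) = 0"
proof -
  let ?A = "mat (Suc (Suc M)) (Suc (Suc M)) (\<lambda>(i, k). (L(Suc M := L j)) k (monom 1 i))"
  have "L j (wave L M) = det ?A"
    using cdet_extended_wave[OF assms(1), of L M j] by (simp add: cdet_def)
  also have "\<dots> = 0"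
    using \<open>j \<le> M\<close> by (intro det_identical_columns[of _ "Suc (Suc M)" j "Suc M"]) (auto simp: Matrix.col_def)
  finally show ?thesis .
qed

text \<open>The additional functional is evaluation at \<open>-c\<close>. In the Newton basis at
  \<open>-c\<close> its column has a single nonzero entry, in row 0, and the minor left over has
  rows \<open>(x+c) x^i\<close>, which is \<open>tau\<close> after the shift in direction
  \<open>c\<close>.\<close>

lemma poly_wave:
  fixes L :: "nat \<Rightarrow> 'a::field_char_0 poly \<Rightarrow> 'a"
  assumes "\<And>j. poly_functional (L j)"
  shows "poly (wave L M) (- c) = (-1) ^ Suc M * tau (twist L [:c, 1:]) M"
proof -
  define E :: "'a poly \<Rightarrow> 'a" where "E = (\<lambda>P. poly P (- c))"
  have E: "poly_functional E" by (rule poly_functionalI) (auto simp: E_def)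
  have L: "poly_functional ((L(Suc M := E)) j)" for j
    using assms E by simp
  define P where "P i = (case i of 0 \<Rightarrow> 1 | Suc k \<Rightarrow> [:c, 1:] * monom (1::'a) k)" for i
  have EP: "E (P k) = (if k = 0 then 1 else 0)" for k
    by (cases k) (auto simp: P_def E_def)
  have "poly (wave L M) (- c) = cdet (L(Suc M := E)) (Suc (Suc M)) (\<lambda>i. 1 * monom 1 i)"
    using cdet_extended_wave[OF E, of L M] by (simp add: E_def)
  also have "\<dots> = cdet (L(Suc M := E)) (Suc (Suc M)) (\<lambda>i. 1 * P i)"
    unfolding P_def by (rule cdet_newton_basis[symmetric]) (rule L)
  also have "\<dots> = (-1) ^ Suc M * cdet L (Suc M) (\<lambda>i. P (Suc i))"
    by (simp only: cdet_extended mult_1 EP)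
      (simp add: if_distrib[of "\<lambda>x. x * _"] sum_negf cong: if_cong del: sum.atMost_Suc)
  also have "cdet L (Suc M) (\<lambda>i. P (Suc i)) = tau (twist L [:c, 1:]) M"
    by (simp add: tau_def cdet_twist P_def del: mult_pCons_left)
  finally show ?thesis .
qed

section \<open>Bordered determinants and interpolation\<close>

lemma border_functional:
  assumes "\<And>j. poly_functional (L j)"
  shows "poly_functional (border L M e)"
proof -
  have "border L M e = (\<lambda>X. cdet L (Suc M) ((\<lambda>i. e * monom 1 i)(M := X)))"
    by (intro ext) (auto simp: border_def intro!: cdet_cong)
  thus ?thesis using cdet_row_functional[of M "Suc M" L] assms by simp
qed

lemma border_null:
  assumes "\<And>j. j \<le> M \<Longrightarrow> L j X = 0"
  shows "border L M e X = 0"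
  unfolding border_def using assms by (intro cdet_eq_0_null_row[of M _ _ X]) auto

text \<open>Terms of \<open>Q\<close> below degree \<open>M\<close> repeat one of the first
  \<open>M\<close> rows, so only the coefficients at \<open>M\<close>, \<open>M+1\<close> and
  \<open>M+2\<close> survive.\<close>

lemma border_multiple:
  assumes lin: "\<And>j. poly_functional (L j)" and deg: "degree Q \<le> M + 2"
  shows "border L M e (e * Q) = coeff Q M * tau (twist L e) M
    + coeff Q (M + 1) * gap (twist L e) M M + coeff Q (M + 2) * hook (twist L e) M"
proof -
  have low: "border L M e (e * monom 1 i) = 0" if "i < M" for i
    unfolding border_def using that by (intro cdet_eq_0_equal_rows[of i M]) auto
  have top: "border L M e (e * monom 1 M) = tau (twist L e) M"
    "border L M e (e * monom 1 (M + 1)) = gap (twist L e) M M"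
    "border L M e (e * monom 1 (M + 2)) = hook (twist L e) M"
    unfolding border_def tau_def gap_def hook_def cdet_twist by (auto intro!: cdet_cong)
  have "border L M e (e * Q) = (\<Sum>i\<le>Suc (Suc M). coeff Q i * border L M e (e * monom 1 i))"
    using deg by (intro poly_functional_monom_expansion border_functional lin) simp
  also have "{..Suc (Suc M)} = insert (M + 2) (insert (M + 1) (insert M {..<M}))" by auto
  finally show ?thesis by (simp add: low top[simplified])
qed

text \<open>Moving the last row to the top costs the sign \<open>(-1)^M\<close> and leaves the rows
  \<open>d, d(x+c), d(x+c)x, ...\<close>, which are \<open>d\<close> times a Newton basis.\<close>

lemma border_divisor:
  fixes L :: "nat \<Rightarrow> 'a::field_char_0 poly \<Rightarrow> 'a"
  assumes "\<And>j. poly_functional (L j)"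
  shows "border L M (d * [:c, 1:]) d = (-1) ^ M * tau (twist L d) M"
proof -
  define P where "P i = (case i of 0 \<Rightarrow> 1 | Suc k \<Rightarrow> [:c, 1:] * monom (1::'a) k)" for i
  let ?B = "mat (Suc M) (Suc M) (\<lambda>(i, j). L j (if i = M then d else d * [:c, 1:] * monom 1 i))"
  have "border L M (d * [:c, 1:]) d = det ?B"
    by (simp add: border_def cdet_def del: mult_pCons_right)
  also have "\<dots> = (-1) ^ M * det (mat (Suc M) (Suc M) (\<lambda>(i, j). ?B $$ (if i < 1 then i + M else if i < M + 1 then i - 1 else i, j)))"
    using det_swap_initial_rows[of ?B "Suc M" M 1] by simp
  also have "det (mat (Suc M) (Suc M) (\<lambda>(i, j). ?B $$ (if i < 1 then i + M else if i < M + 1 then i - 1 else i, j)))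
      = cdet L (Suc M) (\<lambda>i. d * P i)"
    unfolding cdet_def
    by (intro arg_cong[of _ _ det] eq_matI) (auto simp: P_def mult.assoc split: nat.splits simp del: mult_pCons_left mult_pCons_right)
  also have "\<dots> = cdet L (Suc M) (\<lambda>i. d * monom 1 i)"
    unfolding P_def by (rule cdet_newton_basis) (rule assms)
  finally show ?thesis by (simp add: tau_def cdet_twist)
qed

text \<open>Two synthetic divisions, at \<open>-p\<close> and then at \<open>-q\<close>; the
  remainder is the linear interpolant at these points. Scaling by \<open>p - q\<close> clears the
  denominators of Lagrange's formula.\<close>

lemma lagrange_division:
  fixes P :: "'a::field poly"
  obtains Q where
    "Polynomial.smult (p - q) P = Polynomial.smult (poly P (- q)) [:p, 1:]
      - Polynomial.smult (poly P (- p)) [:q, 1:]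
      + Polynomial.smult (p - q) ([:p, 1:] * [:q, 1:] * Q)"
    "degree Q \<le> degree P - 2"
    "\<And>k. coeff P (k + 2) = coeff Q k + (p + q) * coeff Q (k + 1) + p * q * coeff Q (k + 2)"
proof -
  define R where "R = synthetic_div P (- p)"
  define Q where "Q = synthetic_div R (- q)"
  have P: "P = [:p, 1:] * R + [:poly P (- p):]"
    using synthetic_div_correct'[of "- p" P] by (simp add: R_def)
  have R: "R = [:q, 1:] * Q + [:poly R (- q):]"
    using synthetic_div_correct'[of "- q" R] by (simp add: Q_def)
  have Pq: "poly P (- q) = (p - q) * poly R (- q) + poly P (- p)"
    by (subst P) (simp add: algebra_simps)
  show ?thesis
  proof (rule that[of Q])
    show "degree Q \<le> degree P - 2" by (simp add: Q_def R_def degree_synthetic_div)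
    have cP: "coeff P (Suc k) = p * coeff R (Suc k) + coeff R k" for k
      by (subst P) simp
    have cR: "coeff R (Suc k) = q * coeff Q (Suc k) + coeff Q k" for k
      by (subst R) simp
    show "coeff P (k + 2) = coeff Q k + (p + q) * coeff Q (k + 1) + p * q * coeff Q (k + 2)" for k
      by (simp add: cP cR algebra_simps)
    have "Polynomial.smult (p - q) P = Polynomial.smult (p - q) ([:p, 1:] * ([:q, 1:] * Q + [:poly R (- q):]) + [:poly P (- p):])"
      using P R by simp
    also have "\<dots> = Polynomial.smult (p - q) ([:p, 1:] * [:q, 1:] * Q)
        + (Polynomial.smult (p - q) ([:p, 1:] * [:poly R (- q):] + [:poly P (- p):]))"
      by (simp only: distrib_left smult_add_right mult.assoc add.assoc)
    also have "Polynomial.smult (p - q) ([:p, 1:] * [:poly R (- q):] + [:poly P (- p):])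
      = Polynomial.smult (poly P (- q)) [:p, 1:] - Polynomial.smult (poly P (- p)) [:q, 1:]"
      by (simp add: Pq algebra_simps)
    finally show "Polynomial.smult (p - q) P = Polynomial.smult (poly P (- q)) [:p, 1:]
      - Polynomial.smult (poly P (- p)) [:q, 1:]
      + Polynomial.smult (p - q) ([:p, 1:] * [:q, 1:] * Q)" by simp
  qed
qed

section \<open>Identities valid for arbitrary functionals\<close>

text \<open>
  With \<open>tau\<close> shifted in direction \<open>z\<close> equal to \<open>wave\<close> at \<open>-z\<close>, this holds identically in \<open>z\<close>; its two leading
  coefficients are the first four identities and the seventh.
\<close>

lemma hirota_miwa:
  fixes L :: "nat \<Rightarrow> 'a::field_char_0 poly \<Rightarrow> 'a"
  assumes lin: "\<And>j. poly_functional (L j)"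
  shows "(a - p) * tau (twist L ([:a, 1:] * [:p, 1:])) M * tau (twist L [:z, 1:]) M
    + (p - z) * tau (twist L [:a, 1:]) M * tau (twist L ([:p, 1:] * [:z, 1:])) M
    + (z - a) * tau (twist L [:p, 1:]) M * tau (twist L ([:a, 1:] * [:z, 1:])) M = 0"
proof -
  define F where "F = wave (twist L [:a, 1:]) M"
  define \<phi> where "\<phi> = border L M ([:p, 1:] * [:z, 1:])"
  have fun\<phi>: "poly_functional \<phi>" unfolding \<phi>_def by (rule border_functional[OF lin])
  obtain Q where Q: "Polynomial.smult (p - z) ([:a, 1:] * F) =
        Polynomial.smult (poly ([:a, 1:] * F) (- z)) [:p, 1:]
      - Polynomial.smult (poly ([:a, 1:] * F) (- p)) [:z, 1:]
      + Polynomial.smult (p - z) ([:p, 1:] * [:z, 1:] * Q)"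
    and degQ: "degree Q \<le> degree ([:a, 1:] * F) - 2"
    and coeffQ: "\<And>k. coeff ([:a, 1:] * F) (k + 2) = coeff Q k + (p + z) * coeff Q (k + 1) + p * z * coeff Q (k + 2)"
    using lagrange_division[of p z "[:a, 1:] * F"] by blast
  \<comment> \<open>The quotient \<open>Q\<close> has degree at most \<open>M\<close>, so
    \<open>border\<close> sees only its coefficient at \<open>M\<close>, which is the coefficient of
    \<open>x^(M+2)\<close> in \<open>(x+a) F\<close>.\<close>
  have "degree ([:a, 1:] * F) \<le> M + 2"
    using degree_mult_le[of "[:a, 1:]" F] degree_wave[of "twist L [:a, 1:]" M] by (simp add: F_def del: mult_pCons_left)
  with degQ have degQ: "degree Q \<le> M" by simp
  hence "coeff Q (M + 1) = 0" "coeff Q (M + 2) = 0" by (auto intro: coeff_eq_0)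
  moreover from this have "coeff Q M = tau (twist L [:a, 1:]) M"
    using coeffQ[of M] by (simp add: F_def coeff_wave gap_top)
  ultimately have \<phi>Q: "\<phi> ([:p, 1:] * [:z, 1:] * Q) =
      tau (twist L [:a, 1:]) M * tau (twist L ([:p, 1:] * [:z, 1:])) M"
    unfolding \<phi>_def using border_multiple[OF lin, where Q = Q and M = M and e = "[:p, 1:] * [:z, 1:]"] degQ
    by (simp del: mult_pCons_left mult_pCons_right)
  \<comment> \<open>Since \<open>F\<close> is formed after the shift in direction \<open>a\<close>,
    the original functionals annihilate \<open>(x+a) F\<close>.\<close>
  have "\<phi> ([:a, 1:] * F) = 0"
    unfolding \<phi>_def F_def using wave_null[OF twist_functional[OF lin]]
    by (intro border_null) (simp add: twist_def del: mult_pCons_left)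
  hence "\<phi> (Polynomial.smult (p - z) ([:a, 1:] * F)) = 0"
    by (simp only: poly_functional_smult[OF fun\<phi>] mult_zero_right)
  moreover have "\<phi> [:p, 1:] = (-1) ^ M * tau (twist L [:p, 1:]) M"
    unfolding \<phi>_def by (rule border_divisor[OF lin])
  \<comment> \<open>The product \<open>(x+p)(x+z)\<close> is symmetric, so the previous evaluation
    applies with \<open>p\<close> and \<open>z\<close> exchanged.\<close>
  moreover have "\<phi> [:z, 1:] = (-1) ^ M * tau (twist L [:z, 1:]) M"
    unfolding \<phi>_def mult.commute[of "[:p, 1:]"] by (rule border_divisor[OF lin])
  ultimately have "poly ([:a, 1:] * F) (- z) * ((-1) ^ M * tau (twist L [:p, 1:]) M)
      - poly ([:a, 1:] * F) (- p) * ((-1) ^ M * tau (twist L [:z, 1:]) M)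
      + (p - z) * (tau (twist L [:a, 1:]) M * tau (twist L ([:p, 1:] * [:z, 1:])) M) = 0"
    by (simp only: Q poly_functional_add[OF fun\<phi>] poly_functional_diff[OF fun\<phi>] poly_functional_smult[OF fun\<phi>] \<phi>Q)
  moreover have "poly ([:a, 1:] * F) (- c) = (a - c) * ((-1) ^ Suc M * tau (twist L ([:a, 1:] * [:c, 1:])) M)" for c
    using poly_wave[where L = "twist L [:a, 1:]" and M = M and c = c, OF twist_functional, OF lin]
    by (simp add: F_def algebra_simps del: mult_pCons_left mult_pCons_right)
  ultimately have "(a - z) * ((-1) ^ Suc M * tau (twist L ([:a, 1:] * [:z, 1:])) M) * ((-1) ^ M * tau (twist L [:p, 1:]) M)
      - (a - p) * ((-1) ^ Suc M * tau (twist L ([:a, 1:] * [:p, 1:])) M) * ((-1) ^ M * tau (twist L [:z, 1:]) M)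
      + (p - z) * (tau (twist L [:a, 1:]) M * tau (twist L ([:p, 1:] * [:z, 1:])) M) = 0"
    by simp
  thus ?thesis by (simp add: algebra_simps del: mult_pCons_left mult_pCons_right)
qed

text \<open>By \<open>poly_wave\<close> the values at \<open>y\<close> are, up to a common sign, the
  terms of \<open>hirota_miwa\<close> at \<open>z = -y\<close>; agreement at every \<open>y\<close>
  gives equality of polynomials.\<close>

lemma wave_relation:
  fixes L :: "nat \<Rightarrow> 'a::field_char_0 poly \<Rightarrow> 'a"
  assumes lin: "\<And>j. poly_functional (L j)"
  shows "Polynomial.smult ((a - p) * tau (twist L ([:a, 1:] * [:p, 1:])) M) (wave L M)
    + Polynomial.smult (tau (twist L [:a, 1:]) M) ([:p, 1:] * wave (twist L [:p, 1:]) M)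
    = Polynomial.smult (tau (twist L [:p, 1:]) M) ([:a, 1:] * wave (twist L [:a, 1:]) M)"
proof (rule poly_ext)
  fix y
  have W: "poly (wave L M) y = (-1) ^ Suc M * tau (twist L [:- y, 1:]) M"
    using poly_wave[OF lin, where M = M and c = "- y"] by simp
  have Wc: "poly (wave (twist L [:c, 1:]) M) y = (-1) ^ Suc M * tau (twist L ([:c, 1:] * [:- y, 1:])) M" for c
    using poly_wave[where L = "twist L [:c, 1:]" and M = M and c = "- y", OF twist_functional, OF lin]
    by (simp del: mult_pCons_left mult_pCons_right)
  have "poly (Polynomial.smult ((a - p) * tau (twist L ([:a, 1:] * [:p, 1:])) M) (wave L M)
      + Polynomial.smult (tau (twist L [:a, 1:]) M) ([:p, 1:] * wave (twist L [:p, 1:]) M)) y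
      - poly (Polynomial.smult (tau (twist L [:p, 1:]) M) ([:a, 1:] * wave (twist L [:a, 1:]) M)) y
    = (-1) ^ Suc M * ((a - p) * tau (twist L ([:a, 1:] * [:p, 1:])) M * tau (twist L [:- y, 1:]) M
      + (p - - y) * tau (twist L [:a, 1:]) M * tau (twist L ([:p, 1:] * [:- y, 1:])) M
      + (- y - a) * tau (twist L [:p, 1:]) M * tau (twist L ([:a, 1:] * [:- y, 1:])) M)"
    by (simp only: poly_add poly_smult poly_mult W Wc) (simp add: algebra_simps del: mult_pCons_left mult_pCons_right)
  also have "\<dots> = 0"
    by (simp only: hirota_miwa[OF lin] mult_zero_right)
  finally show "poly (Polynomial.smult ((a - p) * tau (twist L ([:a, 1:] * [:p, 1:])) M) (wave L M)
      + Polynomial.smult (tau (twist L [:a, 1:]) M) ([:p, 1:] * wave (twist L [:p, 1:]) M)) y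
    = poly (Polynomial.smult (tau (twist L [:p, 1:]) M) ([:a, 1:] * wave (twist L [:a, 1:]) M)) y"
    by (simp only: right_minus_eq)
qed

text \<open>The symbol \<open>|0..N-3,N-1,N|\<close> lists too many indices when \<open>N = 1\<close>.\<close>

definition gap2 :: "(nat \<Rightarrow> 'a::comm_ring_1 poly \<Rightarrow> 'a) \<Rightarrow> nat \<Rightarrow> 'a" where
  "gap2 L M = (if M = 0 then 0 else gap L M (M - 1))"

text \<open>The coefficient of \<open>x^(M-1)\<close> is read off after multiplying by
  \<open>x\<close>; for \<open>M = 0\<close> this gives 0, in agreement with
  \<open>gap2\<close>.\<close>

lemma wave_top_coeffs:
  "coeff (wave L M) (Suc M) = tau L M"
  "coeff (wave L M) M = - gap L M M"
  "coeff (pCons 0 (wave L M)) M = gap2 L M"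
proof -
  show "coeff (wave L M) (Suc M) = tau L M" "coeff (wave L M) M = - gap L M M"
    by (simp_all add: coeff_wave gap_top)
  show "coeff (pCons 0 (wave L M)) M = gap2 L M"
    by (cases M) (simp_all add: gap2_def coeff_wave)
qed

lemma linear_times_wave_coeffs:
  "coeff ([:c, 1:] * wave L M) (M + 2) = tau L M"
  "coeff ([:c, 1:] * wave L M) (M + 1) = c * tau L M - gap L M M"
  "coeff ([:c, 1:] * wave L M) M = gap2 L M - c * gap L M M"
proof -
  have 0: "coeff (wave L M) (Suc (Suc M)) = 0" by (simp add: coeff_wave)
  show "coeff ([:c, 1:] * wave L M) (M + 2) = tau L M"
    "coeff ([:c, 1:] * wave L M) (M + 1) = c * tau L M - gap L M M"
    "coeff ([:c, 1:] * wave L M) M = gap2 L M - c * gap L M M"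
    using 0 wave_top_coeffs[of L M] by simp_all
qed

lemma degree_linear_times_wave: "degree ([:c, 1:] * wave L M) \<le> M + 2"
  using degree_mult_le[of "[:c, 1:]" "wave L M"] degree_wave[of L M]
  by (auto intro: le_trans simp del: mult_pCons_left split: if_splits)

text \<open>Comparison of the coefficients of \<open>x^(M+1)\<close> in
  \<open>wave_relation\<close>; those of \<open>x^(M+2)\<close> agree trivially.\<close>

lemma tau_gap_relation:
  fixes L :: "nat \<Rightarrow> 'a::field_char_0 poly \<Rightarrow> 'a" and M :: nat
  assumes lin: "\<And>j. poly_functional (L j)"
  defines "T \<equiv> \<lambda>c. tau (twist L [:c, 1:]) M" and "g \<equiv> \<lambda>c. gap (twist L [:c, 1:]) M M"
  shows "T a * (a * T p + g p) + (p - a) * tau (twist L ([:a, 1:] * [:p, 1:])) M * tau L M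
    - (p * T a + g a) * T p = 0"
proof -
  have "coeff (Polynomial.smult ((a - p) * tau (twist L ([:a, 1:] * [:p, 1:])) M) (wave L M)
      + Polynomial.smult (T a) ([:p, 1:] * wave (twist L [:p, 1:]) M)) (M + 1)
    = coeff (Polynomial.smult (T p) ([:a, 1:] * wave (twist L [:a, 1:]) M)) (M + 1)"
    unfolding T_def by (simp only: wave_relation[OF lin])
  hence "(a - p) * tau (twist L ([:a, 1:] * [:p, 1:])) M * tau L M + T a * (p * T p - g p)
      = T p * (a * T a - g a)"
    unfolding coeff_add coeff_smult linear_times_wave_coeffs T_def g_def
    by (simp only: wave_top_coeffs Suc_eq_plus1[symmetric])
  thus ?thesis by (simp add: algebra_simps del: mult_pCons_left mult_pCons_right)
qed

text \<open>Comparison of the coefficients of \<open>x^M\<close> in \<open>wave_relation\<close>,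
  plus \<open>a\<close> times \<open>tau_gap_relation\<close>.\<close>

lemma gap_gap2_relation:
  fixes L :: "nat \<Rightarrow> 'a::field_char_0 poly \<Rightarrow> 'a" and M :: nat
  assumes lin: "\<And>j. poly_functional (L j)"
  defines "T \<equiv> \<lambda>c. tau (twist L [:c, 1:]) M" and "g \<equiv> \<lambda>c. gap (twist L [:c, 1:]) M M"
    and "s \<equiv> \<lambda>c. gap2 (twist L [:c, 1:]) M"
  shows "T a * (a\<^sup>2 * T p + a * g p + s p) - p * T a * (a * T p + g p)
    + (p - a) * tau (twist L ([:a, 1:] * [:p, 1:])) M * (a * tau L M + gap L M M) - T p * s a = 0"
proof -
  define T2 where "T2 = tau (twist L ([:a, 1:] * [:p, 1:])) M"
  have 1: "T a * (a * T p + g p) + (p - a) * T2 * tau L M - (p * T a + g a) * T p = 0"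
    unfolding T_def g_def T2_def by (rule tau_gap_relation[OF lin])
  have "coeff (Polynomial.smult ((a - p) * T2) (wave L M)
      + Polynomial.smult (T a) ([:p, 1:] * wave (twist L [:p, 1:]) M)) M
    = coeff (Polynomial.smult (T p) ([:a, 1:] * wave (twist L [:a, 1:]) M)) M"
    unfolding T_def T2_def by (simp only: wave_relation[OF lin])
  hence 2: "(a - p) * T2 * (- gap L M M) + T a * (s p - p * g p) - T p * (s a - a * g a) = 0"
    unfolding coeff_add coeff_smult linear_times_wave_coeffs T_def g_def s_def
    by (simp only: wave_top_coeffs right_minus_eq)
  have "T a * (a\<^sup>2 * T p + a * g p + s p) - p * T a * (a * T p + g p)
      + (p - a) * T2 * (a * tau L M + gap L M M) - T p * s a
    = a * (T a * (a * T p + g p) + (p - a) * T2 * tau L M - (p * T a + g a) * T p)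
      + ((a - p) * T2 * (- gap L M M) + T a * (s p - p * g p) - T p * (s a - a * g a))"
    by (simp add: algebra_simps power2_eq_square)
  also have "\<dots> = 0" by (simp only: 1 2) simp
  finally show ?thesis unfolding T2_def .
qed

text \<open>Here \<open>e = 1\<close>, so the annihilated \<open>(x+p)\<close> times the shifted
  \<open>wave\<close> needs no interpolation: its three top coefficients already give the
  identity.\<close>

lemma tau_hook_relation:
  fixes L :: "nat \<Rightarrow> 'a::field_char_0 poly \<Rightarrow> 'a" and p :: 'a
  assumes lin: "\<And>j. poly_functional (L j)"
  defines "Lp \<equiv> twist L [:p, 1:]"
  shows "tau Lp M * (p * gap L M M + hook L M) - gap Lp M M * (p * tau L M + gap L M M)
    + tau L M * gap2 Lp M = 0"
proof -
  have L1: "twist L 1 = L" by (simp add: twist_def)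
  have "border L M 1 (1 * ([:p, 1:] * wave Lp M)) = 0"
    unfolding mult_1
  proof (rule border_null)
    fix j assume "j \<le> M"
    hence "Lp j (wave Lp M) = 0"
      unfolding Lp_def by (intro wave_null twist_functional lin)
    thus "L j ([:p, 1:] * wave Lp M) = 0" by (simp add: Lp_def twist_def)
  qed
  thus ?thesis
    unfolding border_multiple[OF lin degree_linear_times_wave] linear_times_wave_coeffs L1
    by (simp add: algebra_simps)
qed

section \<open>The identity that depends on the quartic\<close>

text \<open>By \<open>reduce\<close> the quartic \<open>(x+a)(x^3 + s2 x^2 + s1 x + s0)\<close> acts
  on each functional as a scalar, so its product with \<open>wave L M\<close> stays annihilated. The
  cubic times \<open>wave\<close> is interpolated at \<open>-p\<close> and
  \<open>-q\<close>.\<close>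

lemma reduced_relation:
  fixes L :: "nat \<Rightarrow> 'a::field_char_0 poly \<Rightarrow> 'a" and a p q :: 'a
  assumes lin: "\<And>j. poly_functional (L j)"
    and reduce: "\<And>j P. L j ([:a, 1:] * [:s0, s1, s2, 1:] * P) = c j * L j P"
  defines "L3 \<equiv> twist L ([:a, 1:] * [:p, 1:] * [:q, 1:])"
  shows "(p - q) *
     (tau L M * hook L3 M
      + ((s2 - p - q) * tau L M - gap L M M) * gap L3 M M
      + ((s1 - p * q - (p + q) * (s2 - p - q)) * tau L M - (s2 - p - q) * gap L M M + gap2 L M) * tau L3 M)
    + poly [:s0, s1, s2, 1:] (- p) * tau (twist L [:p, 1:]) M * tau (twist L ([:a, 1:] * [:q, 1:])) M
    - poly [:s0, s1, s2, 1:] (- q) * tau (twist L [:q, 1:]) M * tau (twist L ([:a, 1:] * [:p, 1:])) M = 0"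
proof -
  define S where "S = [:s0, s1, s2, 1:]"
  define e where "e = [:a, 1:] * [:p, 1:] * [:q, 1:]"
  define X where "X = S * wave L M"
  \<comment> \<open>The factor \<open>x+a\<close>, common to the quartic and to \<open>e\<close>, is
    absorbed into the functional, so that only \<open>(x+p)(x+q)\<close> has to be divided
    out.\<close>
  define \<phi> where "\<phi> = (\<lambda>P. border L M e ([:a, 1:] * P))"
  have fun\<phi>: "poly_functional \<phi>"
    by (rule poly_functionalI)
      (simp_all add: \<phi>_def distrib_left poly_functional_add[OF border_functional, OF lin]
        poly_functional_smult[OF border_functional, OF lin] del: mult_pCons_left)
  obtain Q where Q: "Polynomial.smult (p - q) X = Polynomial.smult (poly X (- q)) [:p, 1:]
      - Polynomial.smult (poly X (- p)) [:q, 1:] + Polynomial.smult (p - q) ([:p, 1:] * [:q, 1:] * Q)"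
    and degQ: "degree Q \<le> degree X - 2"
    and coeffQ: "\<And>k. coeff X (k + 2) = coeff Q k + (p + q) * coeff Q (k + 1) + p * q * coeff Q (k + 2)"
    using lagrange_division[of p q X] by blast
  have "degree S = 3" by (simp add: S_def)
  hence "degree X \<le> M + 4"
    using degree_mult_le[of S "wave L M"] degree_wave[of L M] by (simp add: X_def)
  with degQ have degQ: "degree Q \<le> M + 2" by simp
  hence Q34: "coeff Q (M + 3) = 0" "coeff Q (M + 4) = 0" by (auto intro: coeff_eq_0)
  have w0: "coeff (wave L M) (Suc (Suc M)) = 0" "coeff (wave L M) (Suc (Suc (Suc M))) = 0"
    "coeff (wave L M) (Suc (Suc (Suc (Suc M)))) = 0" by (simp_all add: coeff_wave)
  have X: "coeff X (M + 2 + 2) = tau L M" "coeff X (M + 1 + 2) = s2 * tau L M - gap L M M"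
    "coeff X (M + 2) = s1 * tau L M - s2 * gap L M M + gap2 L M"
    using w0 wave_top_coeffs[of L M] by (simp_all add: X_def S_def numeral_eq_Suc)
  \<comment> \<open>The coefficients of \<open>Q\<close> vanish beyond \<open>M+2\<close>, so the
    recurrence \<open>coeffQ\<close> determines the top three from above.\<close>
  have Q2: "coeff Q (M + 2) = tau L M"
    using coeffQ[of "M + 2"] Q34 unfolding X by (simp add: numeral_eq_Suc)
  have Q1: "coeff Q (M + 1) = (s2 - p - q) * tau L M - gap L M M"
    using coeffQ[of "M + 1"] Q34 Q2 unfolding X by (simp add: numeral_eq_Suc algebra_simps)
  have Q0: "coeff Q M = (s1 - p * q - (p + q) * (s2 - p - q)) * tau L M - (s2 - p - q) * gap L M M + gap2 L M"
  proof -
    have "coeff Q M = coeff X (M + 2) - (p + q) * coeff Q (M + 1) - p * q * coeff Q (M + 2)"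
      using coeffQ[of M] by simp
    thus ?thesis unfolding X Q1 Q2 by (simp add: algebra_simps)
  qed
  have \<phi>Q: "\<phi> ([:p, 1:] * [:q, 1:] * Q) =
      coeff Q M * tau L3 M + coeff Q (M + 1) * gap L3 M M + coeff Q (M + 2) * hook L3 M"
    using border_multiple[OF lin degQ, where e = e]
    by (simp add: \<phi>_def e_def L3_def mult.assoc del: mult_pCons_left mult_pCons_right)
  have "\<phi> X = 0"
    unfolding \<phi>_def
  proof (rule border_null)
    fix j assume "j \<le> M"
    thus "L j ([:a, 1:] * X) = 0"
      using reduce[of j "wave L M"] wave_null[where L = L and j = j and M = M, OF lin]
      by (simp add: X_def S_def mult.assoc del: mult_pCons_left mult_pCons_right)
  qed
  hence "\<phi> (Polynomial.smult (p - q) X) = 0"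
    by (simp only: poly_functional_smult[OF fun\<phi>] mult_zero_right)
  moreover have "\<phi> [:p, 1:] = (-1) ^ M * tau (twist L ([:a, 1:] * [:p, 1:])) M"
    unfolding \<phi>_def e_def by (rule border_divisor[OF lin])
  moreover have "\<phi> [:q, 1:] = (-1) ^ M * tau (twist L ([:a, 1:] * [:q, 1:])) M"
    using border_divisor[OF lin, where d = "[:a, 1:] * [:q, 1:]" and c = p and M = M]
    unfolding \<phi>_def e_def by (simp only: mult_ac)
  moreover have "poly X (- d) = poly S (- d) * ((-1) ^ Suc M * tau (twist L [:d, 1:]) M)" for d
    using poly_wave[OF lin, where M = M and c = d] by (simp add: X_def)
  ultimately have "poly S (- q) * ((-1) ^ Suc M * tau (twist L [:q, 1:]) M) * ((-1) ^ M * tau (twist L ([:a, 1:] * [:p, 1:])) M)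
      - poly S (- p) * ((-1) ^ Suc M * tau (twist L [:p, 1:]) M) * ((-1) ^ M * tau (twist L ([:a, 1:] * [:q, 1:])) M)
      + (p - q) * (coeff Q M * tau L3 M + coeff Q (M + 1) * gap L3 M M + coeff Q (M + 2) * hook L3 M) = 0"
    by (simp only: Q poly_functional_add[OF fun\<phi>] poly_functional_diff[OF fun\<phi>] poly_functional_smult[OF fun\<phi>] \<phi>Q)
  thus ?thesis
    unfolding S_def[symmetric] Q0 Q1 Q2
    by (simp add: algebra_simps del: mult_pCons_left mult_pCons_right)
qed

section \<open>Casoratians of sums over the roots\<close>

text \<open>The cutoff at \<open>N\<close> lets the shift and reduction laws hold for every index
  \<open>i\<close>, although the data are constrained only for the rows in
  \<open>1..N\<close>.\<close>

definition root_functional :: "(nat \<Rightarrow> nat \<Rightarrow> complex) \<Rightarrow> (nat \<Rightarrow> nat \<Rightarrow> complex) \<Rightarrow>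
    complex \<Rightarrow> complex \<Rightarrow> complex \<Rightarrow> complex \<Rightarrow> nat \<Rightarrow> int \<Rightarrow> int \<Rightarrow> int \<Rightarrow> int \<Rightarrow> nat \<Rightarrow> complex poly \<Rightarrow> complex" where
  "root_functional \<rho> \<omega> p q a b N n m \<alpha> \<beta> i P = (if i < N then
     \<Sum>j\<in>{1..4::nat}. \<rho> j (i + 1) * poly P (- \<omega> (i + 1) j) * (p - \<omega> (i + 1) j) powi n * (q - \<omega> (i + 1) j) powi m
        * (a - \<omega> (i + 1) j) powi \<alpha> * (b - \<omega> (i + 1) j) powi \<beta> else 0)"

lemma root_functional: "poly_functional (root_functional \<rho> \<omega> p q a b N n m \<alpha> \<beta> i)"
  by (rule poly_functionalI)
    (auto simp: root_functional_def sum.distrib[symmetric] sum_distrib_left algebra_simps intro!: sum.cong)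

lemma casor_eq_cdet:
  assumes "length ls = N"
  shows "casor N \<rho> \<omega> p q a b n m \<alpha> \<beta> ls = cdet (root_functional \<rho> \<omega> p q a b N n m \<alpha> \<beta>) N (\<lambda>i. monom 1 (ls ! i))"
proof -
  let ?A = "mat N N (\<lambda>(i, j). psi \<rho> \<omega> p q a b (i + 1) n m \<alpha> \<beta> (ls ! j))"
  have "casor N \<rho> \<omega> p q a b n m \<alpha> \<beta> ls = det (transpose_mat ?A)"
    using assms by (simp add: casor_def det_transpose[of _ N])
  also have "transpose_mat ?A = mat N N (\<lambda>(i, j). root_functional \<rho> \<omega> p q a b N n m \<alpha> \<beta> j (monom 1 (ls ! i)))"
    by (intro eq_matI) (simp_all add: psi_def root_functional_def poly_monom)
  finally show ?thesis by (simp add: cdet_def)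
qed

lemma casor_runs:
  fixes \<rho> \<omega> p q a b n m \<alpha> \<beta> M
  defines "L \<equiv> root_functional \<rho> \<omega> p q a b (Suc M) n m \<alpha> \<beta>"
  shows "casor (Suc M) \<rho> \<omega> p q a b n m \<alpha> \<beta> [0..<Suc M] = tau L M"
    and "casor (Suc M) \<rho> \<omega> p q a b n m \<alpha> \<beta> ([0..<Suc M - 1] @ [Suc M]) = gap L M M"
    and "casor (Suc M) \<rho> \<omega> p q a b n m \<alpha> \<beta> ([0..<Suc M - 1] @ [Suc M + 1]) = hook L M"
    and "casor (Suc M) \<rho> \<omega> p q a b n m \<alpha> \<beta> ([0..<Suc M - 2] @ [Suc M - 1, Suc M]) = gap2 L M"
proof -
  show "casor (Suc M) \<rho> \<omega> p q a b n m \<alpha> \<beta> [0..<Suc M] = tau L M"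
    by (auto simp: casor_eq_cdet L_def tau_def simp del: upt_Suc intro!: cdet_cong)
  show "casor (Suc M) \<rho> \<omega> p q a b n m \<alpha> \<beta> ([0..<Suc M - 1] @ [Suc M]) = gap L M M"
    by (auto simp: casor_eq_cdet L_def gap_def nth_append less_Suc_eq intro!: cdet_cong)
  show "casor (Suc M) \<rho> \<omega> p q a b n m \<alpha> \<beta> ([0..<Suc M - 1] @ [Suc M + 1]) = hook L M"
    by (auto simp: casor_eq_cdet L_def hook_def nth_append less_Suc_eq intro!: cdet_cong)
  show "casor (Suc M) \<rho> \<omega> p q a b n m \<alpha> \<beta> ([0..<Suc M - 2] @ [Suc M - 1, Suc M]) = gap2 L M"
  proof (cases M)
    \<comment> \<open>For \<open>N = 1\<close> the list is \<open>[0, 1]\<close>, one index too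
      many, and both sides are 0 by convention.\<close>
    case 0
    thus ?thesis by (simp add: casor_def gap2_def)
  next
    case (Suc K)
    have "([0..<K] @ [Suc K, Suc (Suc K)]) ! i = (if i < K then i else Suc i)" if "i < Suc (Suc K)" for i
      using that by (cases "i = K"; cases "i = Suc K") (auto simp: nth_append)
    thus ?thesis
      by (auto simp: casor_eq_cdet L_def gap2_def gap_def Suc intro!: cdet_cong)
  qed
qed

text \<open>At \<open>x = -\<omega>\<close> the factor \<open>x+c\<close> is
  \<open>c - \<omega>\<close>. It is nonzero, so multiplying by it raises the integer exponent by
  one even from \<open>-1\<close> to 0.\<close>

lemma twist_root_functional:
  assumes "\<forall>r\<in>{1..N}. \<forall>j\<in>{1..4::nat}. \<omega> r j \<notin> {p, q, a, b}"
  shows "twist (root_functional \<rho> \<omega> p q a b N n m \<alpha> \<beta>) [:p, 1:] = root_functional \<rho> \<omega> p q a b N (n + 1) m \<alpha> \<beta>"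
    and "twist (root_functional \<rho> \<omega> p q a b N n m \<alpha> \<beta>) [:q, 1:] = root_functional \<rho> \<omega> p q a b N n (m + 1) \<alpha> \<beta>"
    and "twist (root_functional \<rho> \<omega> p q a b N n m \<alpha> \<beta>) [:a, 1:] = root_functional \<rho> \<omega> p q a b N n m (\<alpha> + 1) \<beta>"
proof -
  have nz: "p \<noteq> \<omega> (Suc i) j" "q \<noteq> \<omega> (Suc i) j" "a \<noteq> \<omega> (Suc i) j"
    if "i < N" "j \<in> {1..4}" for i j
    using assms[rule_format, of "Suc i" j] that by auto
  show "twist (root_functional \<rho> \<omega> p q a b N n m \<alpha> \<beta>) [:p, 1:] = root_functional \<rho> \<omega> p q a b N (n + 1) m \<alpha> \<beta>"
    "twist (root_functional \<rho> \<omega> p q a b N n m \<alpha> \<beta>) [:q, 1:] = root_functional \<rho> \<omega> p q a b N n (m + 1) \<alpha> \<beta>"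
    "twist (root_functional \<rho> \<omega> p q a b N n m \<alpha> \<beta>) [:a, 1:] = root_functional \<rho> \<omega> p q a b N n m (\<alpha> + 1) \<beta>"
    by (intro ext; simp add: twist_def root_functional_def del: mult_pCons_left sum.cl_ivl_Suc;
        intro impI sum.cong refl; simp add: nz power_int_add_1; simp add: algebra_simps)+
qed

text \<open>\<open>Gfun\<close> is a difference \<open>V x - V y\<close> of values of one quartic,
  and \<open>V (-\<omega>) = V (-k)\<close> for all four roots, so \<open>G(-\<omega>, y)\<close>
  does not depend on the root chosen.\<close>

lemma root_functional_reduction:
  assumes roots: "\<forall>r\<in>{1..N}. \<forall>z. Gfun \<alpha>1 \<alpha>2 \<alpha>3 (- z) (- k r) = (\<Prod>j\<in>{1..4::nat}. (z - \<omega> r j))"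
    and R: "\<And>x. poly R x = Gfun \<alpha>1 \<alpha>2 \<alpha>3 x y"
  shows "root_functional \<rho> \<omega> p q a b N n m \<alpha> \<beta> i (R * P)
    = Gfun \<alpha>1 \<alpha>2 \<alpha>3 (- k (i + 1)) y * root_functional \<rho> \<omega> p q a b N n m \<alpha> \<beta> i P"
proof (cases "i < N")
  case True
  have "poly (R * P) (- \<omega> (i + 1) j) = Gfun \<alpha>1 \<alpha>2 \<alpha>3 (- k (i + 1)) y * poly P (- \<omega> (i + 1) j)"
    if "j \<in> {1..4}" for j
  proof -
    have "(\<Prod>t\<in>{1..4}. \<omega> (i + 1) j - \<omega> (i + 1) t) = 0"
      using that by (intro prod_zero bexI[of _ j]) auto
    hence "Gfun \<alpha>1 \<alpha>2 \<alpha>3 (- \<omega> (i + 1) j) (- k (i + 1)) = 0"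
      using roots True by auto
    hence "Gfun \<alpha>1 \<alpha>2 \<alpha>3 (- \<omega> (i + 1) j) y = Gfun \<alpha>1 \<alpha>2 \<alpha>3 (- k (i + 1)) y"
      by (simp add: Gfun_def algebra_simps)
    thus ?thesis by (simp only: poly_mult R)
  qed
  thus ?thesis
    unfolding root_functional_def if_P[OF True] sum_distrib_left
    by (intro sum.cong refl) (simp only: mult_ac)
qed (simp add: root_functional_def)

text \<open>Horner's scheme for dividing \<open>G(x, -a)\<close> by its factor
  \<open>x+a\<close>.\<close>

lemma Gfun_quotient:
  "(a + x) * poly [:\<alpha>1 - a * (\<alpha>2 - a * (\<alpha>3 - a)), \<alpha>2 - a * (\<alpha>3 - a), \<alpha>3 - a, 1:] x
    = Gfun \<alpha>1 \<alpha>2 \<alpha>3 x (- a)"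
  by (simp add: Gfun_def algebra_simps power4_eq_xxxx power3_eq_cube power2_eq_square)

theorem theorem4p1:
  fixes \<alpha>1 \<alpha>2 \<alpha>3 p q a b :: complex
    and N :: nat and k :: "nat \<Rightarrow> complex"
    and \<omega> :: "nat \<Rightarrow> nat \<Rightarrow> complex" and \<rho> :: "nat \<Rightarrow> nat \<Rightarrow> complex"
    and \<beta> :: int
    and f g h s :: "int \<Rightarrow> int \<Rightarrow> int \<Rightarrow> complex"
    and pa qa :: complex
  assumes N: "N \<ge> 1"
    and distinct: "p \<noteq> q" "p \<noteq> a" "p \<noteq> b" "q \<noteq> a" "q \<noteq> b" "a \<noteq> b"
    and roots: "\<forall>r\<in>{1..N}. \<omega> r 4 = k r \<and>
        (\<forall>z. Gfun \<alpha>1 \<alpha>2 \<alpha>3 (- z) (- k r) = (\<Prod>j\<in>{1..4::nat}. (z - \<omega> r j)))"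
    and nonzero: "\<forall>r\<in>{1..N}. \<forall>j\<in>{1..4::nat}. \<omega> r j \<notin> {p, q, a, b}"
    and pa_def: "pa = Gfun \<alpha>1 \<alpha>2 \<alpha>3 (- p) (- a) / (p - a)"
    and qa_def: "qa = Gfun \<alpha>1 \<alpha>2 \<alpha>3 (- q) (- a) / (q - a)"
    and f_def: "\<And>n m \<alpha>. f n m \<alpha> = casor N \<rho> \<omega> p q a b n m \<alpha> \<beta> [0..<N]"
    and g_def: "\<And>n m \<alpha>. g n m \<alpha> = casor N \<rho> \<omega> p q a b n m \<alpha> \<beta> ([0..<N - 1] @ [N])"
    and h_def: "\<And>n m \<alpha>. h n m \<alpha> = casor N \<rho> \<omega> p q a b n m \<alpha> \<beta> ([0..<N - 1] @ [N + 1])"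
    and s_def: "\<And>n m \<alpha>. s n m \<alpha> = casor N \<rho> \<omega> p q a b n m \<alpha> \<beta> ([0..<N - 2] @ [N - 1, N])"
  shows "f n m \<alpha> * (a * f (n+1) m (\<alpha>-1) + g (n+1) m (\<alpha>-1)) + (p - a) * f (n+1) m \<alpha> * f n m (\<alpha>-1)
           - (p * f n m \<alpha> + g n m \<alpha>) * f (n+1) m (\<alpha>-1) = 0
    \<and> f n m \<alpha> * (a * f n (m+1) (\<alpha>-1) + g n (m+1) (\<alpha>-1)) + (q - a) * f n (m+1) \<alpha> * f n m (\<alpha>-1)
           - (q * f n m \<alpha> + g n m \<alpha>) * f n (m+1) (\<alpha>-1) = 0
    \<and> f n m \<alpha> * (a^2 * f (n+1) m (\<alpha>-1) + a * g (n+1) m (\<alpha>-1) + s (n+1) m (\<alpha>-1))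
           - p * f n m \<alpha> * (a * f (n+1) m (\<alpha>-1) + g (n+1) m (\<alpha>-1))
           + (p - a) * f (n+1) m \<alpha> * (a * f n m (\<alpha>-1) + g n m (\<alpha>-1))
           - f (n+1) m (\<alpha>-1) * s n m \<alpha> = 0
    \<and> f n m \<alpha> * (a^2 * f n (m+1) (\<alpha>-1) + a * g n (m+1) (\<alpha>-1) + s n (m+1) (\<alpha>-1))
           - q * f n m \<alpha> * (a * f n (m+1) (\<alpha>-1) + g n (m+1) (\<alpha>-1))
           + (q - a) * f n (m+1) \<alpha> * (a * f n m (\<alpha>-1) + g n m (\<alpha>-1))
           - f n (m+1) (\<alpha>-1) * s n m \<alpha> = 0
    \<and> f (n+1) m \<alpha> * (p * g n m \<alpha> + h n m \<alpha>) - g (n+1) m \<alpha> * (p * f n m \<alpha> + g n m \<alpha>)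
           + f n m \<alpha> * s (n+1) m \<alpha> = 0
    \<and> f n (m+1) \<alpha> * (q * g n m \<alpha> + h n m \<alpha>) - g n (m+1) \<alpha> * (q * f n m \<alpha> + g n m \<alpha>)
           + f n m \<alpha> * s n (m+1) \<alpha> = 0
    \<and> (p - q) * (f (n+1) m \<alpha> * f n (m+1) \<alpha> - f n m \<alpha> * f (n+1) (m+1) \<alpha>)
           + f (n+1) m \<alpha> * g n (m+1) \<alpha> - f n (m+1) \<alpha> * g (n+1) m \<alpha> = 0
    \<and> (Hfun \<alpha>2 \<alpha>3 p q * f (n+1) (m+1) \<alpha> * f n m (\<alpha>-1) + h (n+1) (m+1) \<alpha> * f n m (\<alpha>-1)
         - (p + q - \<alpha>3) * g (n+1) (m+1) \<alpha> * f n m (\<alpha>-1)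
         + ((p + q - \<alpha>3) * f (n+1) (m+1) \<alpha> - g (n+1) (m+1) \<alpha>) * (a * f n m (\<alpha>-1) + g n m (\<alpha>-1))
         + f (n+1) (m+1) \<alpha> * (a^2 * f n m (\<alpha>-1) + a * g n m (\<alpha>-1) + s n m (\<alpha>-1))) * (p - q)
       - pa * f n (m+1) \<alpha> * f (n+1) m (\<alpha>-1) + qa * f (n+1) m \<alpha> * f n (m+1) (\<alpha>-1) = 0"
proof -
  obtain M where M: "N = Suc M" using N by (cases N) auto
  define B where "B n m \<alpha> = root_functional \<rho> \<omega> p q a b N n m \<alpha> \<beta>" for n m \<alpha>
  have lin: "poly_functional (B n m \<alpha> j)" for n m \<alpha> j
    unfolding B_def by (rule root_functional)
  have f: "tau (B n m \<alpha>) M = f n m \<alpha>" and g: "gap (B n m \<alpha>) M M = g n m \<alpha>"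
    and h: "hook (B n m \<alpha>) M = h n m \<alpha>" and s: "gap2 (B n m \<alpha>) M = s n m \<alpha>" for n m \<alpha>
    unfolding f_def g_def h_def s_def B_def M casor_runs by (rule refl)+
  have tp: "twist (B n m \<alpha>) [:p, 1:] = B (n + 1) m \<alpha>"
    and tq: "twist (B n m \<alpha>) [:q, 1:] = B n (m + 1) \<alpha>"
    and ta: "twist (B n m \<alpha>) [:a, 1:] = B n m (\<alpha> + 1)" for n m \<alpha>
    unfolding B_def by (rule twist_root_functional[OF nonzero])+
  \<comment> \<open>Most identities are based at \<open>\<alpha>-1\<close>, where the twist by
    \<open>x+a\<close> leads back to \<open>\<alpha>\<close>.\<close>
  note shifts = twist_twist[symmetric] tp tq ta f g h s diff_add_cancel

  define s2 where "s2 = \<alpha>3 - a"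
  define s1 where "s1 = \<alpha>2 - a * s2"
  define s0 where "s0 = \<alpha>1 - a * s1"
  have quot: "(a + x) * poly [:s0, s1, s2, 1:] x = Gfun \<alpha>1 \<alpha>2 \<alpha>3 x (- a)" for x
    unfolding s0_def s1_def s2_def by (rule Gfun_quotient)
  \<comment> \<open>The quotient has \<open>a - p\<close> as denominator where \<open>pa\<close> has
    \<open>p - a\<close>, whence the minus signs.\<close>
  have Spq: "poly [:s0, s1, s2, 1:] (- p) = - pa" "poly [:s0, s1, s2, 1:] (- q) = - qa"
    using quot[of "- p"] quot[of "- q"] distinct
    by (simp_all add: pa_def qa_def field_simps del: poly_pCons)
  have "poly ([:a, 1:] * [:s0, s1, s2, 1:]) x = Gfun \<alpha>1 \<alpha>2 \<alpha>3 x (- a)" for x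
    unfolding poly_mult quot[symmetric] by simp
  hence reduce: "B n m (\<alpha>-1) i ([:a, 1:] * [:s0, s1, s2, 1:] * P)
      = Gfun \<alpha>1 \<alpha>2 \<alpha>3 (- k (i + 1)) (- a) * B n m (\<alpha>-1) i P" for i P
    unfolding B_def using roots by (intro root_functional_reduction) blast+
  \<comment> \<open>The seventh identity is the first with \<open>p\<close>, \<open>q\<close> in the
    roles of \<open>a\<close>, \<open>p\<close>, based at \<open>\<alpha>\<close>.\<close>
  note e7 = tau_gap_relation[where L = "B n m \<alpha>" and M = M and a = p and p = q, OF lin, unfolded shifts]
  note e8 = reduced_relation[where L = "B n m (\<alpha>-1)" and M = M and a = a and p = p and q = q,
      OF lin reduce, unfolded shifts Spq]
  show ?thesis
  proof (intro conjI, goal_cases)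
    case 1 show ?case
      by (rule tau_gap_relation[where L = "B n m (\<alpha>-1)" and M = M and a = a and p = p, OF lin, unfolded shifts])
  next
    case 2 show ?case
      by (rule tau_gap_relation[where L = "B n m (\<alpha>-1)" and M = M and a = a and p = q, OF lin, unfolded shifts])
  next
    case 3 show ?case
      by (rule gap_gap2_relation[where L = "B n m (\<alpha>-1)" and M = M and a = a and p = p, OF lin, unfolded shifts])
  next
    case 4 show ?case
      by (rule gap_gap2_relation[where L = "B n m (\<alpha>-1)" and M = M and a = a and p = q, OF lin, unfolded shifts])
  next
    case 5 show ?case
      by (rule tau_hook_relation[where L = "B n m \<alpha>" and M = M and p = p, OF lin, unfolded shifts])
  next
    case 6 show ?case
      by (rule tau_hook_relation[where L = "B n m \<alpha>" and M = M and p = q, OF lin, unfolded shifts])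
  next
    case 7 show ?case using e7 by (simp add: algebra_simps)
  next
    \<comment> \<open>The coefficient \<open>s1 - p*q - (p+q)*(s2-p-q)\<close> equals
      \<open>H(p,q) + a*(p+q-\<alpha>3) + a^2\<close>.\<close>
    case 8 show ?case
      using e8 by (simp add: s1_def s2_def Hfun_def algebra_simps power2_eq_square)
  qed
qed

end
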